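(* Let $\Omega\subset\mathbb{R}^n$ be compact and convex, $f\in C^1(\Omega)$ with $L$-Lipschitz gradient on $\Omega$ ($L>0$), and let $\mathcal{A}$ be a method satisfying the angle condition $\mathrm{SB}_{\mathcal A}(\Omega)=\tau>0$ and such that the SSC procedure always terminates in a finite number of steps. Let $\{x_k\}$ be generated by the first-order method with SSC, and let $K=\frac{\tau}{L(1+\tau)}$. Then $\{f(x_k)\}$ is decreasing, $f(x_k)\to\tilde f\in\mathbb{R}$, and the limit points of $\{x_k\}$ are stationary. Furthermore, let $\{\tilde x_k\}$ be any sequence such that for every $k$: $\tilde x_k$ is one of the points $y_0,\dots,y_T$ generated by the SSC call producing $x_{k+1}$ from $x_k$, $f(x_{k+1})\le f(\tilde x_k)\le f(x_k)-\frac L2\|x_k-\tilde x_k\|^2$, $\|\tilde x_k-x_k\|\le\|x_{k+1}-x_k\|$, and $\|x_k-x_{k+1}\|\ge K\|\pi(T_\Omega(\tilde x_k),-\nabla f(\tilde x_k))\|$. Then $\|\tilde x_k-x_k\|\to0$ and, for every $k$, $$\min_{0\le i\le k}\|\pi(T_\Omega(\tilde x_i),-\nabla f(\tilde x_i))\|\le\min_{0\le i\le k}\frac{\|x_{i+1}-x_i\|}{K}\le\sqrt{\frac{2(f(x_0)-\tilde f)}{K^2L(k+1)}}.$$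
   Context: $\|\cdot\|$ is the Euclidean norm, $\hat c=c/\|c\|$ for $c\ne0$ and $\hat0=0$, $\bar B_R(x)$ the closed ball. $f\in C^1(\Omega)$ means continuously differentiable on an open set containing $\Omega$; $\|\nabla f(x)-\nabla f(y)\|\le L\|x-y\|$ for $x,y\in\Omega$. $T_\Omega(x)=\mathrm{cl}\{w:\exists\lambda>0,\ x+\lambda w\in\Omega\}$, $\pi(C,\cdot)$ is the Euclidean projection on a closed convex set $C$, $\pi_x(g)=\|\pi(T_\Omega(x),g)\|$; $x$ is stationary if $\pi_x(-\nabla f(x))=0$. A method $\mathcal{A}$ assigns to every $(x,g)\in\Omega\times\mathbb{R}^n$ a set $\mathcal{A}(x,g)\subset (T_\Omega(x)\cap\{d:\langle g,d\rangle>0\})\cup\{0\}$ of feasible directions at $x$, with $\mathcal{A}(x,g)=\{0\}$ if $\pi_x(g)=0$ and $0\notin\mathcal{A}(x,g)\ne\emptyset$ otherwise. $\mathrm{DSB}_{\mathcal A}(\Omega,x,g)=\inf_{d\in\mathcal{A}(x,g)}\frac{\langle g,d\rangle}{\pi_x(g)\|d\|}$ if $\pi_x(g)\neq0$, and $=1$ otherwise; $\mathrm{SB}_{\mathcal A}(\Omega)=\inf_{x\in\Omega,g\in\mathbb{R}^n}\mathrm{DSB}_{\mathcal A}(\Omega,x,g)$. First-order method with SSC: from $x_0\in\Omega$, while $x_k$ is not stationary set $x_{k+1}=\mathrm{SSC}(x_k,-\nabla f(x_k))$. If some $x_m$ is stationary, the convention is $x_k=x_m$ (and $\tilde x_k=x_m$)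 for all $k\ge m$. Procedure $\mathrm{SSC}(\bar x,g)$ (with $g=-\nabla f(\bar x)$): set $y_0=\bar x$, $j=0$. (1) Select $d_j\in\mathcal A(y_j,g)$ and a maximal stepsize $\alpha^{(j)}_{\max}>0$ with $y_j+\alpha d_j\in\Omega$ for $\alpha\in[0,\alpha_{\max}^{(j)}]$. If $d_j=0$, return $y_j$. (2) Let $\Omega_j=\bar B_{\|g\|/(2L)}\!\left(\bar x+\frac{g}{2L}\right)\cap\bar B_{\langle g,\hat d_j\rangle/L}(\bar x)$, and let $\beta_j=0$ if $y_j\notin\Omega_j$, $\beta_j=\max\{\beta\ge0:y_j+\beta d_j\in\Omega_j\}$ if $y_j\in\Omega_j$. Set $\alpha_j=\min(\alpha^{(j)}_{\max},\beta_j)$, $y_{j+1}=y_j+\alpha_jd_j$. If $\alpha_j=\beta_j$, return $y_{j+1}$; otherwise set $j=j+1$ and go to (1). The index $T$ is such that the returned point is $y_T$. "Decreasing" means non-increasing. *)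

theory Defs
  imports "HOL-Analysis.Analysis"
begin

definition gradient :: "('a::euclidean_space \<Rightarrow> real) \<Rightarrow> 'a \<Rightarrow> 'a" where
  "gradient f x = (THE D. GDERIV f x :> D)"

definition C1_on :: "'a::euclidean_space set \<Rightarrow> ('a \<Rightarrow> real) \<Rightarrow> bool" where
  "C1_on \<Omega> f \<longleftrightarrow> (\<exists>U. open U \<and> \<Omega> \<subseteq> U \<and> (\<forall>x\<in>U. \<exists>D. GDERIV f x :> D)
                     \<and> continuous_on U (gradient f))"

definition tangent_cone :: "'a::euclidean_space set \<Rightarrow> 'a \<Rightarrow> 'a set" where
  "tangent_cone \<Omega> x = closure {w. \<exists>c>0. x + c *\<^sub>R w \<in> \<Omega>}"

text \<open>The norm of the Euclidean projection of \<open>g\<close> on the tangent cone at \<open>x\<close>.\<close>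

definition proj_norm :: "'a::euclidean_space set \<Rightarrow> 'a \<Rightarrow> 'a \<Rightarrow> real" where
  "proj_norm \<Omega> x g = norm (closest_point (tangent_cone \<Omega> x) g)"

definition stationary :: "'a::euclidean_space set \<Rightarrow> ('a \<Rightarrow> real) \<Rightarrow> 'a \<Rightarrow> bool" where
  "stationary \<Omega> f x \<longleftrightarrow> proj_norm \<Omega> x (- gradient f x) = 0"

definition feasible_direction :: "'a::euclidean_space set \<Rightarrow> 'a \<Rightarrow> 'a \<Rightarrow> bool" where
  "feasible_direction \<Omega> x d \<longleftrightarrow> (\<exists>c>0. x + c *\<^sub>R d \<in> \<Omega>)"

definition direction_method :: "'a::euclidean_space set \<Rightarrow> ('a \<Rightarrow> 'a \<Rightarrow> 'a set) \<Rightarrow> bool" where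
  "direction_method \<Omega> \<A> \<longleftrightarrow> (\<forall>x\<in>\<Omega>. \<forall>g.
      \<A> x g \<subseteq> (tangent_cone \<Omega> x \<inter> {d. g \<bullet> d > 0}) \<union> {0}
    \<and> (\<forall>d\<in>\<A> x g. feasible_direction \<Omega> x d)
    \<and> (if proj_norm \<Omega> x g = 0 then \<A> x g = {0} else 0 \<notin> \<A> x g \<and> \<A> x g \<noteq> {}))"

definition DSB :: "('a::euclidean_space \<Rightarrow> 'a \<Rightarrow> 'a set) \<Rightarrow> 'a set \<Rightarrow> 'a \<Rightarrow> 'a \<Rightarrow> real" where
  "DSB \<A> \<Omega> x g =
     (if proj_norm \<Omega> x g \<noteq> 0
      then INF d\<in>\<A> x g. (g \<bullet> d) / (proj_norm \<Omega> x g * norm d) else 1)"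

definition SB :: "('a::euclidean_space \<Rightarrow> 'a \<Rightarrow> 'a set) \<Rightarrow> 'a set \<Rightarrow> real" where
  "SB \<A> \<Omega> = (INF (x, g)\<in>\<Omega> \<times> UNIV. DSB \<A> \<Omega> x g)"

text \<open>The maximal stepsize used by the procedure need not be the largest feasible one (for instance,
  away steps may be limited by the weights of the active atoms). A stepsize rule \<open>\<sigma>\<close> gives the
  set \<open>\<sigma> y d\<close> of maximal stepsizes that may be selected at \<open>y\<close> along \<open>d\<close>; selecting the largest
  feasible stepsize is the special case where \<open>\<sigma> y d\<close> is a singleton.\<close>

definition stepsize_rule :: "'a::euclidean_space set \<Rightarrow> ('a \<Rightarrow> 'a \<Rightarrow> real set) \<Rightarrow> bool" where
  "stepsize_rule \<Omega> \<sigma> \<longleftrightarrow> (\<forall>y\<in>\<Omega>. \<forall>d. d \<noteq> 0 \<and> feasible_direction \<Omega> y d \<longrightarrow>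
      \<sigma> y d \<noteq> {} \<and> (\<forall>m\<in>\<sigma> y d. m > 0 \<and> (\<forall>\<alpha>\<in>{0..m}. y + \<alpha> *\<^sub>R d \<in> \<Omega>)))"

text \<open>The normalisation \<open>d / \<parallel>d\<parallel>\<close>, with value \<open>0\<close> at \<open>0\<close>, is \<^term>\<open>sgn d\<close>.\<close>

definition SSC_region :: "real \<Rightarrow> 'a::euclidean_space \<Rightarrow> 'a \<Rightarrow> 'a \<Rightarrow> 'a set" where
  "SSC_region L xb g d =
     cball (xb + (1 / (2 * L)) *\<^sub>R g) (norm g / (2 * L)) \<inter> cball xb ((g \<bullet> sgn d) / L)"

definition SSC_beta :: "real \<Rightarrow> 'a::euclidean_space \<Rightarrow> 'a \<Rightarrow> 'a \<Rightarrow> 'a \<Rightarrow> real" where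
  "SSC_beta L xb g y d =
     (if y \<notin> SSC_region L xb g d then 0
      else (GREATEST \<beta>. \<beta> \<ge> 0 \<and> y + \<beta> *\<^sub>R d \<in> SSC_region L xb g d))"

text \<open>One execution of the loop body at \<open>y\<close> with a nonzero direction: \<open>\<alpha>\<close>, \<open>\<beta>\<close> are the values
  computed from some admissible selection, and \<open>y'\<close> is the next point.\<close>

definition SSC_step :: "real \<Rightarrow> ('a::euclidean_space \<Rightarrow> 'a \<Rightarrow> 'a set) \<Rightarrow> ('a \<Rightarrow> 'a \<Rightarrow> real set)
    \<Rightarrow> 'a \<Rightarrow> 'a \<Rightarrow> 'a \<Rightarrow> real \<Rightarrow> real \<Rightarrow> 'a \<Rightarrow> bool" where
  "SSC_step L \<A> \<sigma> xb g y \<alpha> \<beta> y' \<longleftrightarrow>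
     (\<exists>d\<in>\<A> y g. d \<noteq> 0 \<and> (\<exists>m\<in>\<sigma> y d.
        \<beta> = SSC_beta L xb g y d \<and> \<alpha> = min m \<beta> \<and> y' = y + \<alpha> *\<^sub>R d))"

text \<open>\<open>SSC_trace L \<A> \<sigma> xb g y ys\<close>: when the loop of \<open>SSC(xb, g)\<close> is at \<open>y\<close>, it can visit exactly
  the points \<open>ys\<close> from there on (\<open>y\<close> included) and then return the last of them. A complete call is
  the case \<open>y = xb\<close>, where \<open>ys = [y\<^sub>0, \<dots>, y\<^sub>T]\<close>.\<close>

inductive SSC_trace :: "real \<Rightarrow> ('a::euclidean_space \<Rightarrow> 'a \<Rightarrow> 'a set) \<Rightarrow> ('a \<Rightarrow> 'a \<Rightarrow> real set)
    \<Rightarrow> 'a \<Rightarrow> 'a \<Rightarrow> 'a \<Rightarrow> 'a list \<Rightarrow> bool"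
  for L \<A> \<sigma> xb g where
  zero_direction: "0 \<in> \<A> y g \<Longrightarrow> SSC_trace L \<A> \<sigma> xb g y [y]"
| final_step: "SSC_step L \<A> \<sigma> xb g y \<alpha> \<beta> y' \<Longrightarrow> \<alpha> = \<beta> \<Longrightarrow> SSC_trace L \<A> \<sigma> xb g y [y, y']"
| continue_step: "SSC_step L \<A> \<sigma> xb g y \<alpha> \<beta> y' \<Longrightarrow> \<alpha> \<noteq> \<beta> \<Longrightarrow> SSC_trace L \<A> \<sigma> xb g y' ys
    \<Longrightarrow> SSC_trace L \<A> \<sigma> xb g y (y # ys)"

text \<open>No sequence of admissible selections makes the loop run forever.\<close>

definition SSC_terminates :: "'a::euclidean_space set \<Rightarrow> ('a \<Rightarrow> real) \<Rightarrow> real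
    \<Rightarrow> ('a \<Rightarrow> 'a \<Rightarrow> 'a set) \<Rightarrow> ('a \<Rightarrow> 'a \<Rightarrow> real set) \<Rightarrow> bool" where
  "SSC_terminates \<Omega> f L \<A> \<sigma> \<longleftrightarrow> (\<forall>xb\<in>\<Omega>. \<not> (\<exists>y. y 0 = xb \<and>
      (\<forall>j. \<exists>\<alpha> \<beta>. SSC_step L \<A> \<sigma> xb (- gradient f xb) (y j) \<alpha> \<beta> (y (Suc j)) \<and> \<alpha> \<noteq> \<beta>)))"

text \<open>\<open>ys k\<close> lists the points generated by the call that produces \<open>x (Suc k)\<close>. At a stationary
  \<open>x k\<close> it is \<open>[x k]\<close>, which encodes the convention that the sequence, and every choice of a point
  of \<open>ys k\<close>, stays at \<open>x k\<close>.\<close>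

definition SSC_first_order :: "'a::euclidean_space set \<Rightarrow> ('a \<Rightarrow> real) \<Rightarrow> real
    \<Rightarrow> ('a \<Rightarrow> 'a \<Rightarrow> 'a set) \<Rightarrow> ('a \<Rightarrow> 'a \<Rightarrow> real set) \<Rightarrow> (nat \<Rightarrow> 'a) \<Rightarrow> (nat \<Rightarrow> 'a list) \<Rightarrow> bool" where
  "SSC_first_order \<Omega> f L \<A> \<sigma> x ys \<longleftrightarrow> x 0 \<in> \<Omega> \<and> (\<forall>k.
      (if stationary \<Omega> f (x k) then ys k = [x k]
       else SSC_trace L \<A> \<sigma> (x k) (- gradient f (x k)) (x k) (ys k))
    \<and> x (Suc k) = last (ys k))"

end

theory Submission
  imports Defs
begin

text \<open>All points visited by a call of the procedure stay in \<open>\<Omega>\<close> and in the ball where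
  \<open>L * \<parallel>y - x k\<parallel>\<^sup>2 \<le> - gradient f (x k) \<bullet> (y - x k)\<close>. On that ball the quadratic upper model of \<open>f\<close>
  gives \<open>f y \<le> f (x k) - L / 2 * \<parallel>y - x k\<parallel>\<^sup>2\<close> (\<open>SSC_ball_decrease\<close>). Hence \<open>f (x k)\<close> decreases, it
  converges because \<open>f\<close> is bounded on the compact \<open>\<Omega>\<close>, and the squares of the step lengths
  \<open>\<parallel>x (k + 1) - x k\<parallel>\<close> have a sum of at most \<open>2 * (f (x 0) - ft) / L\<close>. The step lengths therefore tend to 0,
  and the smallest of the first \<open>k + 1\<close> of them obeys the stated rate, which passes to
  the projected gradients at the points \<open>xt i\<close> through the inequality that relates them to the steps.

  For the limit points, short steps have to force small projected gradients. Whatever ends a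
  call, its last queried point \<open>w\<close> lies within \<open>2 * \<parallel>x (k + 1) - x k\<parallel>\<close> of \<open>x k\<close>, and the projection of
  \<open>- gradient f (x k)\<close> on the tangent cone at \<open>w\<close> is at most \<open>2 * L / \<tau>\<close> times the step length
  (\<open>SSC_trace_good_point\<close>). Indeed, either that projection is 0, or the call ends at least half of the
  radius of the second ball away from \<open>x k\<close>, and by the angle condition this radius is at least
  \<open>\<tau> / L\<close> times the projection. By the Lipschitz
  condition the same holds, with another constant, for the gradient at \<open>w\<close> itself. So along a
  convergent subsequence the points \<open>w\<close> converge to the same limit and have projected
  gradients tending to 0, and then the limit is stationary (\<open>stationary_limit\<close>), since a small projected
  gradient is an approximate variational inequality over \<open>\<Omega>\<close>.\<close>

section \<open>The tangent cone and the projected gradient\<close>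

lemma convex_cone_tangent_cone:
  fixes \<Omega> :: "'a::euclidean_space set"
  assumes "convex \<Omega>" "x \<in> \<Omega>"
  shows "convex_cone (tangent_cone \<Omega> x)"
proof -
  let ?S = "{w. \<exists>c>0. x + c *\<^sub>R w \<in> \<Omega>}"
  have zero: "0 \<in> ?S"
    using assms(2) by (simp add: gt_ex)
  have scale: "a *\<^sub>R w \<in> ?S" if w: "w \<in> ?S" and a: "a \<ge> 0" for a w
  proof (cases "a = 0")
    case False
    obtain c where c: "c > 0" "x + c *\<^sub>R w \<in> \<Omega>" using w by blast
    have "x + (c / a) *\<^sub>R (a *\<^sub>R w) \<in> \<Omega>" using c False by simp
    moreover have "c / a > 0" using c False a by simp
    ultimately show ?thesis by blast
  qed (use zero in simp)
  have conv: "convex ?S"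
  proof (rule convexI)
    fix v w :: 'a and s t :: real
    assume v: "v \<in> ?S" and w: "w \<in> ?S" and st: "0 \<le> s" "0 \<le> t" "s + t = 1"
    obtain a where a: "a > 0" "x + a *\<^sub>R v \<in> \<Omega>" using v by blast
    obtain b where b: "b > 0" "x + b *\<^sub>R w \<in> \<Omega>" using w by blast
    \<comment> \<open>Shrinking a feasible stepsize keeps it feasible, so \<open>v\<close> and \<open>w\<close> share one.\<close>
    have shrink: "x + c *\<^sub>R u \<in> \<Omega>" if "0 \<le> c" "c \<le> e" "0 < e" "x + e *\<^sub>R u \<in> \<Omega>" for c e u
    proof -
      have "(1 - c / e) *\<^sub>R x + (c / e) *\<^sub>R (x + e *\<^sub>R u) \<in> \<Omega>"
        using that assms by (intro convexD) (auto simp: field_simps)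
      also have "(1 - c / e) *\<^sub>R x + (c / e) *\<^sub>R (x + e *\<^sub>R u) = x + c *\<^sub>R u"
        using that by (simp add: algebra_simps)
      finally show ?thesis .
    qed
    define m where "m = min a b"
    have m: "m > 0" "x + m *\<^sub>R v \<in> \<Omega>" "x + m *\<^sub>R w \<in> \<Omega>"
      using a b shrink[of m a v] shrink[of m b w] by (auto simp: m_def)
    have "s *\<^sub>R (x + m *\<^sub>R v) + t *\<^sub>R (x + m *\<^sub>R w) \<in> \<Omega>"
      using m st assms by (intro convexD) auto
    also have "s *\<^sub>R (x + m *\<^sub>R v) + t *\<^sub>R (x + m *\<^sub>R w)
        = (s + t) *\<^sub>R x + m *\<^sub>R (s *\<^sub>R v + t *\<^sub>R w)"
      by (simp add: algebra_simps)
    finally show "s *\<^sub>R v + t *\<^sub>R w \<in> ?S" using m st by auto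
  qed
  have "conic ?S" unfolding conic_def using scale by blast
  moreover have "?S \<noteq> {}" using zero by blast
  ultimately show ?thesis
    unfolding tangent_cone_def convex_cone_def
    by (intro conjI convex_closure conic_closure conv) simp_all
qed

lemma diff_in_tangent_cone:
  assumes "y \<in> \<Omega>"
  shows "y - x \<in> tangent_cone \<Omega> x"
proof -
  have "y - x \<in> {w. \<exists>c>0. x + c *\<^sub>R w \<in> \<Omega>}"
    by (intro CollectI exI[of _ 1]) (use assms in simp)
  then show ?thesis unfolding tangent_cone_def by (rule subsetD[OF closure_subset])
qed

lemma proj_norm_nonneg: "proj_norm \<Omega> x g \<ge> 0"
  by (simp add: proj_norm_def)

text \<open>Half of Moreau's decomposition: \<open>g\<close> minus its projection on the cone lies in the polar cone, so
  along tangent directions \<open>g\<close> is dominated by its projection.\<close>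

lemma inner_le_proj_norm:
  fixes \<Omega> :: "'a::euclidean_space set"
  assumes "convex \<Omega>" "x \<in> \<Omega>" "y \<in> \<Omega>"
  shows "g \<bullet> (y - x) \<le> proj_norm \<Omega> x g * norm (y - x)"
proof -
  let ?T = "tangent_cone \<Omega> x"
  define p where "p = closest_point ?T g"
  note cc = convex_cone_tangent_cone[OF assms(1,2)]
  have cl: "closed ?T" by (simp add: tangent_cone_def)
  have p: "p \<in> ?T"
    unfolding p_def by (rule closest_point_in_set[OF cl convex_cone_nonempty[OF cc]])
  have "p + (y - x) \<in> ?T"
    using convex_cone_add[OF cc p diff_in_tangent_cone[OF assms(3)]] .
  then have "(g - p) \<bullet> (p + (y - x) - p) \<le> 0"
    unfolding p_def using cc cl by (intro closest_point_dot) (auto simp: convex_cone_def)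
  then have "g \<bullet> (y - x) \<le> p \<bullet> (y - x)" by (simp add: inner_diff_left)
  also have "\<dots> \<le> norm p * norm (y - x)" by (rule norm_cauchy_schwarz)
  finally show ?thesis by (simp add: proj_norm_def p_def)
qed

lemma proj_norm_eq_0I:
  fixes \<Omega> :: "'a::euclidean_space set"
  assumes "convex \<Omega>" "x \<in> \<Omega>" and le: "\<And>y. y \<in> \<Omega> \<Longrightarrow> g \<bullet> (y - x) \<le> 0"
  shows "proj_norm \<Omega> x g = 0"
proof -
  let ?T = "tangent_cone \<Omega> x"
  note cc = convex_cone_tangent_cone[OF assms(1,2)]
  have "{w. \<exists>c>0. x + c *\<^sub>R w \<in> \<Omega>} \<subseteq> {w. g \<bullet> w \<le> 0}"
  proof safe
    fix w :: 'a and c :: real assume "c > 0" "x + c *\<^sub>R w \<in> \<Omega>"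
    then show "g \<bullet> w \<le> 0" using le[of "x + c *\<^sub>R w"] by (simp add: mult_le_0_iff)
  qed
  then have polar: "?T \<subseteq> {w. g \<bullet> w \<le> 0}"
    unfolding tangent_cone_def by (rule closure_minimal) (rule closed_halfspace_le)
  have "0 = closest_point ?T g"
  proof (rule closest_point_unique)
    show "convex ?T" using cc by (simp add: convex_cone_def)
    show "closed ?T" by (simp add: tangent_cone_def)
    show "0 \<in> ?T" using cc by (simp add: convex_cone_iff)
    show "\<forall>z\<in>?T. dist g 0 \<le> dist g z"
    proof
      fix z assume "z \<in> ?T"
      then have "g \<bullet> z \<le> 0" using polar by blast
      then have "(norm g)\<^sup>2 \<le> (norm (g - z))\<^sup>2"
        by (simp add: power2_norm_eq_inner inner_diff inner_commute)
          (smt (verit) inner_ge_zero)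
      then show "dist g 0 \<le> dist g z" by (simp add: dist_norm)
    qed
  qed
  then show ?thesis by (simp add: proj_norm_def)
qed

lemma proj_norm_lipschitz:
  fixes \<Omega> :: "'a::euclidean_space set"
  assumes "convex \<Omega>" "x \<in> \<Omega>"
  shows "proj_norm \<Omega> x g \<le> proj_norm \<Omega> x h + norm (g - h)"
proof -
  let ?T = "tangent_cone \<Omega> x"
  note cc = convex_cone_tangent_cone[OF assms]
  have "dist (closest_point ?T g) (closest_point ?T h) \<le> dist g h"
    using cc convex_cone_nonempty[OF cc]
    by (intro closest_point_lipschitz) (auto simp: convex_cone_def tangent_cone_def)
  then show ?thesis
    unfolding proj_norm_def dist_norm by norm
qed

text \<open>Stationarity is a variational inequality, and variational inequalities pass to the limit: this
  is what replaces continuity of the projected gradient, which fails where the tangent cone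
  jumps.\<close>

lemma stationary_limit:
  fixes \<Omega> :: "'a::euclidean_space set"
  assumes "closed \<Omega>" "convex \<Omega>" and G: "continuous_on \<Omega> (gradient f)"
    and w: "\<And>k. w k \<in> \<Omega>" "w \<longlonglongrightarrow> z"
    and lim: "(\<lambda>k. proj_norm \<Omega> (w k) (- gradient f (w k))) \<longlonglongrightarrow> 0"
  shows "stationary \<Omega> f z"
proof -
  have z: "z \<in> \<Omega>" using closed_sequentially[OF assms(1)] w by blast
  have grad: "(\<lambda>k. gradient f (w k)) \<longlonglongrightarrow> gradient f z"
    using continuous_on_tendsto_compose[OF G w(2) z] w(1) by simp
  have "- gradient f z \<bullet> (y - z) \<le> 0" if "y \<in> \<Omega>" for y
  proof (intro LIMSEQ_le)
    show "(\<lambda>k. - gradient f (w k) \<bullet> (y - w k)) \<longlonglongrightarrow> - gradient f z \<bullet> (y - z)"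
      using grad w(2) by (intro tendsto_intros)
    show "(\<lambda>k. proj_norm \<Omega> (w k) (- gradient f (w k)) * norm (y - w k)) \<longlonglongrightarrow> 0"
      using tendsto_mult[OF lim tendsto_norm[OF tendsto_diff[OF tendsto_const[of y] w(2)]]]
      by simp
    show "\<exists>N. \<forall>n\<ge>N. - gradient f (w n) \<bullet> (y - w n)
        \<le> proj_norm \<Omega> (w n) (- gradient f (w n)) * norm (y - w n)"
      using inner_le_proj_norm[OF assms(2) w(1) that] by blast
  qed
  then show ?thesis
    unfolding stationary_def by (intro proj_norm_eq_0I assms z)
qed

section \<open>Descent\<close>

lemma C1_on_GDERIV:
  assumes "C1_on \<Omega> f" "x \<in> \<Omega>"
  shows "GDERIV f x :> gradient f x"
proof -
  obtain D where D: "GDERIV f x :> D"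
    using assms unfolding C1_on_def by blast
  have "E = D" if "GDERIV f x :> E" for E
  proof -
    have "(\<lambda>h. h \<bullet> E) = (\<lambda>h. h \<bullet> D)"
      using that D unfolding gderiv_def by (rule has_derivative_unique)
    then have "h \<bullet> E = h \<bullet> D" for h by (rule fun_cong)
    then show ?thesis by (rule iffD1[OF vector_eq_ldot, OF allI])
  qed
  with D have "gradient f x = D" unfolding gradient_def by (rule the_equality)
  then show ?thesis using D by simp
qed

lemma C1_on_continuous_on:
  assumes "C1_on \<Omega> f"
  shows "continuous_on \<Omega> f"
  using C1_on_GDERIV[OF assms] has_derivative_continuous
  unfolding gderiv_def by (blast intro: continuous_at_imp_continuous_on)

text \<open>The quadratic upper model of a function with Lipschitz gradient. At \<open>x + t *\<^sub>R (y - x)\<close>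
  the derivative of \<open>f\<close> along the segment exceeds that of the linear model by at most
  \<open>L * t * \<parallel>y - x\<parallel>\<^sup>2\<close>, which is the derivative of the quadratic term.\<close>

lemma lipschitz_gradient_upper_bound:
  fixes f :: "'a::euclidean_space \<Rightarrow> real"
  assumes "convex \<Omega>" "C1_on \<Omega> f" and lip: "L-lipschitz_on \<Omega> (gradient f)"
    and x: "x \<in> \<Omega>" and y: "y \<in> \<Omega>"
  shows "f y \<le> f x + gradient f x \<bullet> (y - x) + L / 2 * (norm (y - x))\<^sup>2"
proof -
  define h where "h = y - x"
  define \<phi> where "\<phi> = (\<lambda>t. f (x + t *\<^sub>R h) - t * (gradient f x \<bullet> h) - L / 2 * t\<^sup>2 * (norm h)\<^sup>2)"
  have seg: "x + t *\<^sub>R h \<in> \<Omega>" if "0 \<le> t" "t \<le> 1" for t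
  proof -
    have "(1 - t) *\<^sub>R x + t *\<^sub>R y \<in> \<Omega>" using that assms by (intro convexD) auto
    then show ?thesis by (simp add: h_def algebra_simps)
  qed
  have "\<phi> 1 \<le> \<phi> 0"
  proof (rule DERIV_nonpos_imp_nonincreasing[of 0 1 \<phi>])
    fix t :: real assume t: "0 \<le> t" "t \<le> 1"
    let ?G = "gradient f (x + t *\<^sub>R h)"
    have "(f has_derivative (\<lambda>v. v \<bullet> ?G)) (at (x + t *\<^sub>R h))"
      using C1_on_GDERIV[OF assms(2) seg[OF t]] by (simp add: gderiv_def)
    then have "((\<lambda>t. f (x + t *\<^sub>R h)) has_derivative (\<lambda>s. (s *\<^sub>R h) \<bullet> ?G)) (at t)"
      by (rule has_derivative_compose[rotated]) (auto intro!: derivative_eq_intros)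
    then have "((\<lambda>t. f (x + t *\<^sub>R h)) has_real_derivative (h \<bullet> ?G)) (at t)"
      unfolding has_field_derivative_def by (simp add: mult_commute_abs)
    then have der: "(\<phi> has_real_derivative
        (h \<bullet> ?G - gradient f x \<bullet> h - L * t * (norm h)\<^sup>2)) (at t)"
      unfolding \<phi>_def by (auto intro!: derivative_eq_intros)
    have "h \<bullet> (?G - gradient f x) \<le> norm h * norm (?G - gradient f x)"
      by (rule norm_cauchy_schwarz)
    also have "\<dots> \<le> norm h * (L * (t * norm h))"
      using lipschitz_onD[OF lip seg[OF t] x] t by (intro mult_left_mono) (auto simp: dist_norm)
    finally have "h \<bullet> ?G - gradient f x \<bullet> h - L * t * (norm h)\<^sup>2 \<le> 0"
      by (simp add: inner_diff_right inner_commute power2_eq_square algebra_simps)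
    with der show "\<exists>D. (\<phi> has_real_derivative D) (at t) \<and> D \<le> 0" by blast
  qed simp
  then show ?thesis by (simp add: \<phi>_def h_def)
qed

text \<open>In this form the first ball of \<^const>\<open>SSC_region\<close> is the set of points where, for
  \<open>g = - gradient f xb\<close>, the linear decrease pays for the quadratic term of the upper model twice, so
  that a net decrease of \<open>L / 2 * \<parallel>y - xb\<parallel>\<^sup>2\<close> is left.\<close>

lemma in_SSC_ball_iff:
  fixes g :: "'a::euclidean_space"
  assumes "L > 0"
  shows "y \<in> cball (xb + (1 / (2 * L)) *\<^sub>R g) (norm g / (2 * L))
    \<longleftrightarrow> L * (norm (y - xb))\<^sup>2 \<le> g \<bullet> (y - xb)"
proof -
  define c where "c = (1 / (2 * L)) *\<^sub>R g"
  define p where "p = y - xb"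
  have c: "norm g / (2 * L) = norm c" using assms by (simp add: c_def)
  have "y \<in> cball (xb + c) (norm c) \<longleftrightarrow> norm (p - c) \<le> norm c"
    by (simp add: dist_norm p_def norm_minus_commute algebra_simps)
  also have "\<dots> \<longleftrightarrow> (norm (p - c))\<^sup>2 \<le> (norm c)\<^sup>2" by simp
  also have "\<dots> \<longleftrightarrow> (norm p)\<^sup>2 \<le> 2 * (c \<bullet> p)"
    by (simp add: power2_norm_eq_inner inner_diff inner_commute algebra_simps)
  also have "2 * (c \<bullet> p) = (g \<bullet> p) / L" by (simp add: c_def)
  also have "(norm p)\<^sup>2 \<le> (g \<bullet> p) / L \<longleftrightarrow> L * (norm p)\<^sup>2 \<le> g \<bullet> p"
    using assms by (simp add: pos_le_divide_eq mult.commute)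
  finally show ?thesis by (simp add: c[folded c_def] c_def[symmetric] p_def)
qed

lemma SSC_ball_decrease:
  fixes f :: "'a::euclidean_space \<Rightarrow> real"
  assumes "convex \<Omega>" "C1_on \<Omega> f" "L-lipschitz_on \<Omega> (gradient f)" "xb \<in> \<Omega>" "y \<in> \<Omega>"
    and "L * (norm (y - xb))\<^sup>2 \<le> - gradient f xb \<bullet> (y - xb)"
  shows "f y \<le> f xb - L / 2 * (norm (y - xb))\<^sup>2"
  using lipschitz_gradient_upper_bound[OF assms(1-5)] assms(6) by simp

section \<open>The procedure\<close>

lemma SB_le_slope:
  fixes \<Omega> :: "'a::euclidean_space set"
  assumes "direction_method \<Omega> \<A>" "y \<in> \<Omega>" "d \<in> \<A> y g" "d \<noteq> 0"
  shows "SB \<A> \<Omega> * proj_norm \<Omega> y g \<le> g \<bullet> sgn d"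
proof -
  have nz: "proj_norm \<Omega> y g \<noteq> 0"
    using assms unfolding direction_method_def by (metis singletonD)
  then have pos: "proj_norm \<Omega> y g > 0" using proj_norm_nonneg[of \<Omega> y g] by simp
  have ratio: "0 \<le> (h \<bullet> e) / (proj_norm \<Omega> v h * norm e)" if "v \<in> \<Omega>" "e \<in> \<A> v h" for v h e
  proof -
    have "0 \<le> h \<bullet> e" using that assms(1) unfolding direction_method_def by fastforce
    then show ?thesis using proj_norm_nonneg[of \<Omega> v h] by simp
  qed
  have DSB0: "0 \<le> DSB \<A> \<Omega> v h" if "v \<in> \<Omega>" for v h
  proof -
    have "proj_norm \<Omega> v h \<noteq> 0 \<Longrightarrow> \<A> v h \<noteq> {}"
      using that assms(1) unfolding direction_method_def by simp
    then show ?thesis unfolding DSB_def using ratio[OF that] by (auto intro!: cINF_greatest)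
  qed
  have "SB \<A> \<Omega> \<le> (case (y, g) of (v, h) \<Rightarrow> DSB \<A> \<Omega> v h)"
    unfolding SB_def by (rule cINF_lower) (use assms(2) DSB0 in \<open>auto intro!: bdd_belowI[of _ 0]\<close>)
  also have "\<dots> = (INF e\<in>\<A> y g. (g \<bullet> e) / (proj_norm \<Omega> y g * norm e))"
    using nz by (simp add: DSB_def)
  also have "\<dots> \<le> (g \<bullet> d) / (proj_norm \<Omega> y g * norm d)"
    by (rule cINF_lower) (use assms ratio in \<open>auto intro!: bdd_belowI[of _ 0]\<close>)
  also have "\<dots> = (g \<bullet> sgn d) / proj_norm \<Omega> y g"
    by (simp add: sgn_div_norm field_simps)
  finally show ?thesis using pos by (simp add: pos_le_divide_eq)
qed

text \<open>The stepsize \<open>SSC_beta\<close> is defined by a greatest element, which exists because the region is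
  compact and \<open>d\<close> is nonzero.\<close>

lemma SSC_beta_greatest:
  assumes "y \<in> SSC_region L xb g d" "d \<noteq> 0"
  defines "\<beta> \<equiv> SSC_beta L xb g y d"
  shows "\<beta> \<ge> 0" "y + \<beta> *\<^sub>R d \<in> SSC_region L xb g d"
    and "\<And>b. b \<ge> 0 \<Longrightarrow> y + b *\<^sub>R d \<in> SSC_region L xb g d \<Longrightarrow> b \<le> \<beta>"
proof -
  let ?R = "SSC_region L xb g d"
  let ?B = "{b. b \<ge> 0 \<and> y + b *\<^sub>R d \<in> ?R}"
  have "bounded ?R" unfolding SSC_region_def by (auto intro: bounded_Int)
  then obtain M where M: "\<And>v. v \<in> ?R \<Longrightarrow> norm v \<le> M" by (auto simp: bounded_iff)
  have bound: "\<bar>b\<bar> \<le> (M + norm y) / norm d" if "b \<in> ?B" for b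
  proof -
    have "norm (b *\<^sub>R d) \<le> norm (y + b *\<^sub>R d) + norm y"
      using norm_triangle_ineq4[of "y + b *\<^sub>R d" y] by simp
    also have "\<dots> \<le> M + norm y" using M that by auto
    finally show ?thesis using assms(2) by (simp add: pos_le_divide_eq)
  qed
  have "closed ({0..} \<inter> (\<lambda>b. y + b *\<^sub>R d) -` ?R)"
    by (intro closed_Int closed_vimage continuous_intros) (auto simp: SSC_region_def intro!: continuous_intros)
  also have "{0..} \<inter> (\<lambda>b. y + b *\<^sub>R d) -` ?R = ?B" by auto
  finally have "compact ?B"
    using bound by (auto simp: compact_eq_bounded_closed bounded_iff)
  moreover have "0 \<in> ?B" using assms(1) by simp
  ultimately obtain m where m: "m \<in> ?B" "\<And>b. b \<in> ?B \<Longrightarrow> b \<le> m"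
    using compact_attains_sup[of ?B] by blast
  have "(GREATEST b. b \<ge> 0 \<and> y + b *\<^sub>R d \<in> ?R) = m"
    by (rule Greatest_equality) (use m in auto)
  then have "\<beta> = m" using assms(1) by (simp add: \<beta>_def SSC_beta_def)
  with m show "\<beta> \<ge> 0" "y + \<beta> *\<^sub>R d \<in> ?R"
    and "\<And>b. b \<ge> 0 \<Longrightarrow> y + b *\<^sub>R d \<in> ?R \<Longrightarrow> b \<le> \<beta>" by auto
qed

text \<open>A maximal step inside the region ends on one of the two spheres. On the sphere around \<open>xb\<close> the
  bound is the definition of its radius. On the other one, a direction leaving the ball makes no
  acute angle with the direction to its centre \<open>xb + g / (2 * L)\<close>, so the end point minus \<open>xb\<close> has at
  least the component \<open>(g \<bullet> sgn d) / (2 * L)\<close> along \<open>d\<close>. Both cases are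
  covered by moving on by a small \<open>\<epsilon>\<close> if the conclusion fails.\<close>

lemma SSC_maximal_step_long:
  assumes "L > 0" "d \<noteq> 0" "y \<in> SSC_region L xb g d"
  shows "g \<bullet> sgn d \<le> 2 * L * norm (y + SSC_beta L xb g y d *\<^sub>R d - xb)"
proof (rule ccontr)
  define \<beta> where "\<beta> = SSC_beta L xb g y d"
  note b = SSC_beta_greatest[OF assms(3,2), folded \<beta>_def]
  define p where "p = y + \<beta> *\<^sub>R d - xb"
  define s where "s = (g \<bullet> sgn d) / L"
  assume "\<not> ?thesis"
  then have lt: "2 * L * norm p < g \<bullet> sgn d" by (simp add: p_def \<beta>_def)
  then have ps: "2 * norm p < s" using assms(1) by (simp add: s_def pos_less_divide_eq mult.commute mult.left_commute)
  have d: "norm d > 0" using assms(2) by simp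
  have "2 * L * (p \<bullet> d) \<le> 2 * L * (norm p * norm d)"
    using assms(1) norm_cauchy_schwarz[of p d] by simp
  also have "\<dots> < (g \<bullet> sgn d) * norm d" using mult_strict_right_mono[OF lt d] by (simp add: mult.assoc)
  also have "\<dots> = g \<bullet> d" using d by (simp add: sgn_div_norm)
  finally have gd: "2 * L * (p \<bullet> d) < g \<bullet> d" .
  define \<epsilon> where "\<epsilon> = min ((s - norm p) / norm d) ((g \<bullet> d - 2 * L * (p \<bullet> d)) / (L * (norm d)\<^sup>2))"
  have e0: "\<epsilon> > 0" unfolding \<epsilon>_def
    using gd d assms(1) ps norm_ge_zero[of p] by (auto simp del: norm_ge_zero)
  have e1: "\<epsilon> * norm d \<le> s - norm p"
  proof -
    have "\<epsilon> \<le> (s - norm p) / norm d" by (simp add: \<epsilon>_def)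
    then show ?thesis using d by (simp add: pos_le_divide_eq)
  qed
  have e2: "\<epsilon> * (L * (norm d)\<^sup>2) \<le> g \<bullet> d - 2 * L * (p \<bullet> d)"
  proof -
    have "\<epsilon> \<le> (g \<bullet> d - 2 * L * (p \<bullet> d)) / (L * (norm d)\<^sup>2)" by (simp add: \<epsilon>_def)
    moreover have "L * (norm d)\<^sup>2 > 0" using d assms(1) by simp
    ultimately show ?thesis by (simp only: pos_le_divide_eq)
  qed
  have pB: "L * (norm p)\<^sup>2 \<le> g \<bullet> p"
    using b(2) in_SSC_ball_iff[OF assms(1)] unfolding SSC_region_def p_def by blast
  have eq: "y + (\<beta> + \<epsilon>) *\<^sub>R d - xb = p + \<epsilon> *\<^sub>R d" by (simp add: p_def algebra_simps)
  have "(norm (p + \<epsilon> *\<^sub>R d))\<^sup>2 = (norm p)\<^sup>2 + 2 * \<epsilon> * (p \<bullet> d) + \<epsilon>\<^sup>2 * (norm d)\<^sup>2"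
    by (simp add: power2_norm_eq_inner inner_add inner_commute power2_eq_square[of \<epsilon>] algebra_simps)
  then have "L * (norm (p + \<epsilon> *\<^sub>R d))\<^sup>2
      = L * (norm p)\<^sup>2 + \<epsilon> * (2 * L * (p \<bullet> d) + \<epsilon> * (L * (norm d)\<^sup>2))"
    by (simp add: power2_eq_square[of \<epsilon>] algebra_simps)
  also have "\<dots> \<le> g \<bullet> p + \<epsilon> * (g \<bullet> d)"
    using pB e2 e0 by (intro add_mono mult_left_mono) auto
  also have "\<dots> = g \<bullet> (p + \<epsilon> *\<^sub>R d)" by (simp add: inner_add_right)
  finally have 1: "y + (\<beta> + \<epsilon>) *\<^sub>R d \<in> cball (xb + (1 / (2 * L)) *\<^sub>R g) (norm g / (2 * L))"
    unfolding in_SSC_ball_iff[OF assms(1)] eq .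
  have "norm (p + \<epsilon> *\<^sub>R d) \<le> norm p + \<epsilon> * norm d"
    using norm_triangle_ineq[of p "\<epsilon> *\<^sub>R d"] e0 by simp
  then have "norm (y + (\<beta> + \<epsilon>) *\<^sub>R d - xb) \<le> s" using e1 eq by simp
  then have 2: "y + (\<beta> + \<epsilon>) *\<^sub>R d \<in> cball xb s" by (simp add: dist_norm norm_minus_commute)
  have "\<beta> + \<epsilon> \<le> \<beta>" using 1 2 b(1) e0 by (intro b(3)) (auto simp: SSC_region_def s_def)
  then show False using e0 by simp
qed

text \<open>The cap by the maximal stepsize keeps the point in \<open>\<Omega>\<close>, and convexity of the first ball keeps
  it in that ball. The second ball changes with the direction and gives no invariant.\<close>

lemma SSC_step_invariant:
  fixes \<Omega> :: "'a::euclidean_space set"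
  assumes "L > 0" "direction_method \<Omega> \<A>" "stepsize_rule \<Omega> \<sigma>"
    and step: "SSC_step L \<A> \<sigma> xb g y \<alpha> \<beta> y'"
    and y: "y \<in> \<Omega>" "L * (norm (y - xb))\<^sup>2 \<le> g \<bullet> (y - xb)"
  shows "y' \<in> \<Omega>" "L * (norm (y' - xb))\<^sup>2 \<le> g \<bullet> (y' - xb)"
proof -
  obtain d m where d: "d \<in> \<A> y g" "d \<noteq> 0" and m: "m \<in> \<sigma> y d"
    and \<beta>: "\<beta> = SSC_beta L xb g y d" and \<alpha>: "\<alpha> = min m \<beta>" and y': "y' = y + \<alpha> *\<^sub>R d"
    using step unfolding SSC_step_def by blast
  have "feasible_direction \<Omega> y d" using assms(2) y(1) d(1) unfolding direction_method_def by blast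
  then have m0: "m > 0" and feas: "\<And>a. 0 \<le> a \<Longrightarrow> a \<le> m \<Longrightarrow> y + a *\<^sub>R d \<in> \<Omega>"
    using assms(3) y(1) d(2) m unfolding stepsize_rule_def by fastforce+
  have "\<beta> \<ge> 0"
    using SSC_beta_greatest(1)[of y L xb g d] d(2) by (auto simp: \<beta> SSC_beta_def)
  then have \<alpha>0: "0 \<le> \<alpha>" "\<alpha> \<le> \<beta>" using m0 by (auto simp: \<alpha>)
  show "y' \<in> \<Omega>" unfolding y' using \<alpha>0 by (intro feas) (auto simp: \<alpha>)
  show "L * (norm (y' - xb))\<^sup>2 \<le> g \<bullet> (y' - xb)"
  proof (cases "y \<in> SSC_region L xb g d \<and> \<beta> \<noteq> 0")
    case True
    let ?B = "cball (xb + (1 / (2 * L)) *\<^sub>R g) (norm g / (2 * L))"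
    have "y \<in> ?B" "y + \<beta> *\<^sub>R d \<in> ?B"
      using SSC_beta_greatest(2)[of y L xb g d] True d(2) by (auto simp: \<beta> SSC_region_def)
    then have "(1 - \<alpha> / \<beta>) *\<^sub>R y + (\<alpha> / \<beta>) *\<^sub>R (y + \<beta> *\<^sub>R d) \<in> ?B"
      using \<alpha>0 True by (intro convexD[OF convex_cball]) (auto simp: field_simps)
    also have "(1 - \<alpha> / \<beta>) *\<^sub>R y + (\<alpha> / \<beta>) *\<^sub>R (y + \<beta> *\<^sub>R d) = y'"
      using True by (simp add: y' algebra_simps)
    finally show ?thesis unfolding in_SSC_ball_iff[OF assms(1)] .
  next
    case False
    then have "\<beta> = 0" by (auto simp: \<beta> SSC_beta_def)
    then have "y' = y" using \<alpha>0 by (simp add: y')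
    then show ?thesis using y(2) by simp
  qed
qed

text \<open>The radius \<open>(g \<bullet> sgn d) / L\<close> of the second ball dominates \<open>SB \<A> \<Omega> * proj_norm \<Omega> y g / L\<close> by the
  angle condition, and the last step ends at least half of that radius away from \<open>xb\<close>. Either \<open>y\<close> is
  in the region and the step is a long maximal step, or \<open>y\<close>, being in the first ball, is outside the
  second one and the step has length zero. The factor 2 comes from the sphere of the first ball.\<close>

lemma SSC_final_step_slope:
  fixes \<Omega> :: "'a::euclidean_space set"
  assumes "L > 0" "direction_method \<Omega> \<A>" "SB \<A> \<Omega> > 0"
    and step: "SSC_step L \<A> \<sigma> xb g y \<alpha> \<beta> y'" "\<alpha> = \<beta>"
    and y: "y \<in> \<Omega>" "L * (norm (y - xb))\<^sup>2 \<le> g \<bullet> (y - xb)"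
  shows "norm (y - xb) \<le> 2 * norm (y' - xb)"
    and "proj_norm \<Omega> y g \<le> 2 * L / SB \<A> \<Omega> * norm (y' - xb)"
proof -
  obtain d where d: "d \<in> \<A> y g" "d \<noteq> 0"
    and \<beta>: "\<beta> = SSC_beta L xb g y d" and "y' = y + \<alpha> *\<^sub>R d"
    using step(1) unfolding SSC_step_def by blast
  then have y': "y' = y + \<beta> *\<^sub>R d" using step(2) by simp
  define s where "s = g \<bullet> sgn d"
  have slope: "SB \<A> \<Omega> * proj_norm \<Omega> y g \<le> s"
    unfolding s_def by (rule SB_le_slope[OF assms(2) y(1) d])
  have *: "norm (y - xb) \<le> 2 * norm (y' - xb) \<and> s \<le> 2 * L * norm (y' - xb)"
  proof (cases "y \<in> SSC_region L xb g d")
    case True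
    have s: "s \<le> 2 * L * norm (y' - xb)"
      using SSC_maximal_step_long[OF assms(1) d(2) True] by (simp add: s_def y' \<beta>)
    have "norm (y - xb) \<le> s / L"
      using True by (simp add: SSC_region_def s_def dist_norm norm_minus_commute)
    also have "\<dots> \<le> 2 * norm (y' - xb)"
      using s assms(1) by (simp add: pos_divide_le_eq mult_ac)
    finally show ?thesis using s by blast
  next
    case False
    then have "y \<notin> cball xb (s / L)"
      using y(2) in_SSC_ball_iff[OF assms(1)] by (auto simp: SSC_region_def s_def)
    then have "s / L < norm (y - xb)" by (simp add: dist_norm norm_minus_commute)
    then have "s < L * norm (y - xb)" using assms(1) by (simp add: pos_divide_less_eq mult.commute)
    moreover have "y' = y" using False by (simp add: y' \<beta> SSC_beta_def)
    moreover have "L * norm (y - xb) \<ge> 0" using assms(1) by simp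
    ultimately show ?thesis by (simp add: mult.assoc)
  qed
  then show "norm (y - xb) \<le> 2 * norm (y' - xb)" by blast
  show "proj_norm \<Omega> y g \<le> 2 * L / SB \<A> \<Omega> * norm (y' - xb)"
    using slope * assms(3) by (simp add: pos_le_divide_eq mult.commute)
qed

text \<open>The point \<open>w\<close> is the last one at which a direction is requested. There the procedure stops
  either because the projection of \<open>g\<close> vanishes or with a final step, and the invariant has been
  carried along the points before it.\<close>

lemma SSC_trace_good_point:
  fixes \<Omega> :: "'a::euclidean_space set"
  assumes "L > 0" "direction_method \<Omega> \<A>" "SB \<A> \<Omega> > 0" "stepsize_rule \<Omega> \<sigma>"
    and trace: "SSC_trace L \<A> \<sigma> xb g y ys"
    and y: "y \<in> \<Omega>" "L * (norm (y - xb))\<^sup>2 \<le> g \<bullet> (y - xb)"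
  shows "last ys \<in> \<Omega> \<and> L * (norm (last ys - xb))\<^sup>2 \<le> g \<bullet> (last ys - xb) \<and>
    (\<exists>w\<in>\<Omega>. norm (w - xb) \<le> 2 * norm (last ys - xb)
        \<and> proj_norm \<Omega> w g \<le> 2 * L / SB \<A> \<Omega> * norm (last ys - xb))"
  using trace y
proof (induction rule: SSC_trace.induct)
  case (zero_direction y)
  then have "proj_norm \<Omega> y g = 0"
    using assms(2) unfolding direction_method_def by metis
  then show ?case using zero_direction assms(1,3) by (intro conjI bexI[of _ y]) auto
next
  case (final_step y \<alpha> \<beta> y')
  then show ?case
    using SSC_step_invariant[OF assms(1,2,4) final_step(1) final_step.prems]
      SSC_final_step_slope[OF assms(1-3) final_step(1,2) final_step.prems]
    by auto
next
  case (continue_step y \<alpha> \<beta> y' ys)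
  have "ys \<noteq> []" using continue_step(3) by (auto elim: SSC_trace.cases)
  then show ?case
    using continue_step.IH SSC_step_invariant[OF assms(1,2,4) continue_step(1) continue_step.prems]
    by simp
qed

section \<open>Convergence\<close>

theorem theorem4p1:
  fixes \<Omega> :: "'a::euclidean_space set"
    and f :: "'a \<Rightarrow> real"
    and L \<tau> K :: real
    and \<A> :: "'a \<Rightarrow> 'a \<Rightarrow> 'a set"
    and \<sigma> :: "'a \<Rightarrow> 'a \<Rightarrow> real set"
    and x :: "nat \<Rightarrow> 'a"
    and ys :: "nat \<Rightarrow> 'a list"
  assumes "compact \<Omega>" and "convex \<Omega>"
    and "C1_on \<Omega> f" and "L > 0" and "L-lipschitz_on \<Omega> (gradient f)"
    and "direction_method \<Omega> \<A>"
    and "SB \<A> \<Omega> = \<tau>" and "\<tau> > 0"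
    and "stepsize_rule \<Omega> \<sigma>"
    and "SSC_terminates \<Omega> f L \<A> \<sigma>"
    and "SSC_first_order \<Omega> f L \<A> \<sigma> x ys"
    and "K = \<tau> / (L * (1 + \<tau>))"
  shows "decseq (\<lambda>k. f (x k)) \<and>
    (\<exists>ft. (\<lambda>k. f (x k)) \<longlonglongrightarrow> ft \<and>
      (\<forall>z r. strict_mono r \<and> (x \<circ> r) \<longlonglongrightarrow> z \<longrightarrow> stationary \<Omega> f z) \<and>
      (\<forall>xt :: nat \<Rightarrow> 'a.
        (\<forall>k. xt k \<in> set (ys k)
           \<and> f (x (Suc k)) \<le> f (xt k)
           \<and> f (xt k) \<le> f (x k) - L / 2 * (norm (x k - xt k))\<^sup>2
           \<and> norm (xt k - x k) \<le> norm (x (Suc k) - x k)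
           \<and> norm (x k - x (Suc k)) \<ge> K * proj_norm \<Omega> (xt k) (- gradient f (xt k)))
        \<longrightarrow> (\<lambda>k. norm (xt k - x k)) \<longlonglongrightarrow> 0 \<and>
            (\<forall>k. (MIN i\<in>{0..k}. proj_norm \<Omega> (xt i) (- gradient f (xt i)))
                   \<le> (MIN i\<in>{0..k}. norm (x (Suc i) - x i) / K)
               \<and> (MIN i\<in>{0..k}. norm (x (Suc i) - x i) / K)
                   \<le> sqrt (2 * (f (x 0) - ft) / (K\<^sup>2 * L * (real k + 1))))))"
proof -
  have Gcont: "continuous_on \<Omega> (gradient f)"
    by (rule lipschitz_on_continuous_on[OF assms(5)])
  have K: "K > 0" using assms(4,8,12) by simp
  define C where "C = 2 * L / \<tau> + 2 * L"
  have iter: "x k \<in> \<Omega> \<and> x (Suc k) \<in> \<Omega> \<and>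
      L * (norm (x (Suc k) - x k))\<^sup>2 \<le> - gradient f (x k) \<bullet> (x (Suc k) - x k) \<and>
      (\<exists>w\<in>\<Omega>. norm (w - x k) \<le> 2 * norm (x (Suc k) - x k) \<and>
        proj_norm \<Omega> w (- gradient f (x k)) \<le> 2 * L / \<tau> * norm (x (Suc k) - x k))" for k
  proof -
    have main: "x (Suc k) \<in> \<Omega> \<and>
        L * (norm (x (Suc k) - x k))\<^sup>2 \<le> - gradient f (x k) \<bullet> (x (Suc k) - x k) \<and>
        (\<exists>w\<in>\<Omega>. norm (w - x k) \<le> 2 * norm (x (Suc k) - x k) \<and>
          proj_norm \<Omega> w (- gradient f (x k)) \<le> 2 * L / \<tau> * norm (x (Suc k) - x k))"
      if xk: "x k \<in> \<Omega>" for k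
    proof (cases "stationary \<Omega> f (x k)")
      case True
      then have "x (Suc k) = x k" using assms(11) unfolding SSC_first_order_def by simp
      then show ?thesis using xk True unfolding stationary_def by auto
    next
      case False
      then have tr: "SSC_trace L \<A> \<sigma> (x k) (- gradient f (x k)) (x k) (ys k)"
        and l: "x (Suc k) = last (ys k)"
        using assms(11) unfolding SSC_first_order_def by auto
      show ?thesis
        unfolding l assms(7)[symmetric]
        by (rule SSC_trace_good_point[OF assms(4,6) _ assms(9) tr xk]) (use assms(7,8) in auto)
    qed
    have "x k \<in> \<Omega>"
    proof (induction k)
      case 0
      show ?case using assms(11) unfolding SSC_first_order_def by simp
    qed (use main in blast)
    then show ?thesis using main by blast
  qed
  define \<Delta> where "\<Delta> = (\<lambda>k. norm (x (Suc k) - x k))"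
  have decrease: "f (x (Suc k)) \<le> f (x k) - L / 2 * (\<Delta> k)\<^sup>2" for k
    unfolding \<Delta>_def using iter by (intro SSC_ball_decrease[OF assms(2,3,5)]) auto
  have dec: "decseq (\<lambda>k. f (x k))"
  proof (rule decseq_SucI)
    fix k
    have "L / 2 * (\<Delta> k)\<^sup>2 \<ge> 0" using assms(4) by simp
    then show "f (x (Suc k)) \<le> f (x k)" using decrease[of k] by simp
  qed
  have "bounded (f ` \<Omega>)"
    by (intro compact_imp_bounded compact_continuous_image C1_on_continuous_on assms(1,3))
  then obtain B where "\<And>y. y \<in> \<Omega> \<Longrightarrow> \<bar>f y\<bar> \<le> B" by (auto simp: bounded_iff)
  then have "- B \<le> f (x k)" for k using iter[of k] by (metis abs_le_D2 minus_le_iff)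
  then obtain ft where ft: "(\<lambda>k. f (x k)) \<longlonglongrightarrow> ft" "\<And>k. ft \<le> f (x k)"
    using decseq_convergent[OF dec] by blast
  have summed: "(\<Sum>i\<le>k. (\<Delta> i)\<^sup>2) \<le> 2 * (f (x 0) - f (x (Suc k))) / L" for k
  proof (induction k)
    case 0
    show ?case using decrease[of 0] assms(4) by (simp add: field_simps)
  next
    case (Suc k)
    have "(\<Delta> (Suc k))\<^sup>2 \<le> 2 * (f (x (Suc k)) - f (x (Suc (Suc k)))) / L"
      using decrease[of "Suc k"] assms(4) by (simp add: field_simps)
    then show ?case using Suc by (simp add: diff_divide_distrib right_diff_distrib)
  qed
  have \<Delta>0: "\<Delta> \<longlonglongrightarrow> 0"
  proof -
    have "(\<lambda>k. 2 * (f (x k) - f (x (Suc k))) / L) \<longlonglongrightarrow> 2 * (ft - ft) / L"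
      using ft(1) LIMSEQ_Suc[OF ft(1)] assms(4) by (intro tendsto_intros) auto
    then have lim: "(\<lambda>k. 2 * (f (x k) - f (x (Suc k))) / L) \<longlonglongrightarrow> 0" by simp
    have "(\<lambda>k. (\<Delta> k)\<^sup>2) \<longlonglongrightarrow> 0"
    proof (rule tendsto_sandwich[OF _ _ tendsto_const lim])
      show "\<forall>\<^sub>F k in sequentially. (\<Delta> k)\<^sup>2 \<le> 2 * (f (x k) - f (x (Suc k))) / L"
        using decrease assms(4) by (intro always_eventually allI) (simp add: field_simps)
    qed simp
    then have "(\<lambda>k. sqrt ((\<Delta> k)\<^sup>2)) \<longlonglongrightarrow> sqrt 0" by (rule tendsto_real_sqrt)
    then show ?thesis by (simp add: \<Delta>_def)
  qed
  have limit_points: "stationary \<Omega> f z" if r: "strict_mono r" "(x \<circ> r) \<longlonglongrightarrow> z" for z r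
  proof -
    obtain w where w: "\<And>k. w k \<in> \<Omega>" "\<And>k. norm (w k - x k) \<le> 2 * \<Delta> k"
      and pw: "\<And>k. proj_norm \<Omega> (w k) (- gradient f (x k)) \<le> 2 * L / \<tau> * \<Delta> k"
      using iter unfolding \<Delta>_def by metis
    \<comment> \<open>Moving the gradient from \<open>x k\<close> to \<open>w k\<close> costs at most \<open>L * \<parallel>w k - x k\<parallel> \<le> 2 * L * \<Delta> k\<close>.\<close>
    have pw': "proj_norm \<Omega> (w k) (- gradient f (w k)) \<le> C * \<Delta> k" for k
    proof -
      have "norm (- gradient f (w k) - - gradient f (x k)) \<le> L * norm (w k - x k)"
        using lipschitz_onD[OF assms(5) w(1)[of k], of "x k"] iter[of k]
        by (simp add: dist_norm norm_minus_commute)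
      also have "\<dots> \<le> L * (2 * \<Delta> k)" using w(2)[of k] assms(4) by simp
      finally show ?thesis
        using proj_norm_lipschitz[OF assms(2) w(1)[of k], of "- gradient f (w k)" "- gradient f (x k)"]
          pw[of k] by (simp add: C_def algebra_simps)
    qed
    have \<Delta>r: "(\<lambda>k. \<Delta> (r k)) \<longlonglongrightarrow> 0"
      using LIMSEQ_subseq_LIMSEQ[OF \<Delta>0 r(1)] by (simp add: o_def)
    have "(\<lambda>k. w (r k) - x (r k)) \<longlonglongrightarrow> 0"
    proof (rule Lim_null_comparison)
      show "\<forall>\<^sub>F k in sequentially. norm (w (r k) - x (r k)) \<le> 2 * \<Delta> (r k)" using w(2) by simp
      show "(\<lambda>k. 2 * \<Delta> (r k)) \<longlonglongrightarrow> 0" using tendsto_mult_left[OF \<Delta>r, of 2] by simp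
    qed
    from tendsto_add[OF this r(2)] have "(\<lambda>k. w (r k)) \<longlonglongrightarrow> z" by simp
    moreover have "(\<lambda>k. proj_norm \<Omega> (w (r k)) (- gradient f (w (r k)))) \<longlonglongrightarrow> 0"
    proof (rule Lim_null_comparison)
      show "\<forall>\<^sub>F k in sequentially.
          norm (proj_norm \<Omega> (w (r k)) (- gradient f (w (r k)))) \<le> C * \<Delta> (r k)"
        using pw' by (simp add: proj_norm_nonneg)
      show "(\<lambda>k. C * \<Delta> (r k)) \<longlonglongrightarrow> 0" using tendsto_mult_left[OF \<Delta>r, of C] by simp
    qed
    ultimately show ?thesis
      using w(1) by (intro stationary_limit[OF compact_imp_closed[OF assms(1)] assms(2) Gcont]) auto
  qed
  have rate: "(MIN i\<in>{0..k}. \<Delta> i / K) \<le> sqrt (2 * (f (x 0) - ft) / (K\<^sup>2 * L * (real k + 1)))" for k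
  proof (rule real_le_rsqrt)
    define m where "m = (MIN i\<in>{0..k}. \<Delta> i / K)"
    have "m \<in> (\<lambda>i. \<Delta> i / K) ` {0..k}" unfolding m_def by (intro Min_in) auto
    then have m0: "0 \<le> m" using K by (auto simp: \<Delta>_def)
    have "m \<le> \<Delta> i / K" if "i \<le> k" for i
      unfolding m_def using that by (intro Min_le) auto
    then have "m * K \<le> \<Delta> i" if "i \<le> k" for i
      using that K by (simp add: pos_le_divide_eq)
    then have "(\<Sum>i\<le>k. (m * K)\<^sup>2) \<le> (\<Sum>i\<le>k. (\<Delta> i)\<^sup>2)"
      using m0 K by (intro sum_mono power_mono) auto
    also have "\<dots> \<le> 2 * (f (x 0) - f (x (Suc k))) / L" by (rule summed)
    also have "\<dots> \<le> 2 * (f (x 0) - ft) / L"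
      using ft(2) assms(4) by (intro divide_right_mono) auto
    finally have "(real k + 1) * (m * K)\<^sup>2 \<le> 2 * (f (x 0) - ft) / L" by (simp add: add.commute)
    then have "m\<^sup>2 * (K\<^sup>2 * L * (real k + 1)) \<le> 2 * (f (x 0) - ft)"
      using assms(4) by (simp add: pos_le_divide_eq power_mult_distrib mult_ac)
    then show "m\<^sup>2 \<le> 2 * (f (x 0) - ft) / (K\<^sup>2 * L * (real k + 1))"
      using K assms(4) by (subst pos_le_divide_eq) auto
  qed
  have measured: "(MIN i\<in>{0..k}. p i) \<le> (MIN i\<in>{0..k}. \<Delta> i / K)"
    if p: "\<And>i. K * p i \<le> \<Delta> i" for p :: "nat \<Rightarrow> real" and k
  proof -
    have "p i \<le> \<Delta> i / K" for i using p[of i] K by (simp add: pos_le_divide_eq mult.commute)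
    then have "(MIN i\<in>{0..k}. p i) \<le> \<Delta> i / K" if "i \<le> k" for i
      using that by (intro order_trans[OF Min_le[of _ "p i"]]) auto
    then show ?thesis by (subst Min_ge_iff) auto
  qed
  show ?thesis
  proof (intro conjI dec exI[of _ ft] ft(1) allI impI)
    fix z r assume "strict_mono r \<and> (x \<circ> r) \<longlonglongrightarrow> z"
    then show "stationary \<Omega> f z" using limit_points by blast
  next
    fix xt :: "nat \<Rightarrow> 'a"
    assume xt: "\<forall>k. xt k \<in> set (ys k)
           \<and> f (x (Suc k)) \<le> f (xt k)
           \<and> f (xt k) \<le> f (x k) - L / 2 * (norm (x k - xt k))\<^sup>2
           \<and> norm (xt k - x k) \<le> norm (x (Suc k) - x k)
           \<and> norm (x k - x (Suc k)) \<ge> K * proj_norm \<Omega> (xt k) (- gradient f (xt k))"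
    show "(\<lambda>k. norm (xt k - x k)) \<longlonglongrightarrow> 0"
      by (rule tendsto_sandwich[OF _ _ tendsto_const \<Delta>0])
        (use xt in \<open>auto simp: \<Delta>_def intro!: always_eventually\<close>)
    fix k
    have "K * proj_norm \<Omega> (xt i) (- gradient f (xt i)) \<le> \<Delta> i" for i
      using xt by (simp add: \<Delta>_def norm_minus_commute)
    from measured[OF this]
    show "(MIN i\<in>{0..k}. proj_norm \<Omega> (xt i) (- gradient f (xt i)))
        \<le> (MIN i\<in>{0..k}. norm (x (Suc i) - x i) / K)"
      by (simp add: \<Delta>_def)
    show "(MIN i\<in>{0..k}. norm (x (Suc i) - x i) / K)
        \<le> sqrt (2 * (f (x 0) - ft) / (K\<^sup>2 * L * (real k + 1)))"
      using rate[of k] by (simp add: \<Delta>_def)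
  qed
qed

end
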